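(* There exist an absolute constant $C>0$ and an algorithm such that, for every $n\ge1$ and every $\varepsilon>0$, given an explicit description of a distribution $q$ over $[n]$ and sample access to an unknown distribution $p$ over $[n]$, the algorithm draws at most $C\sqrt{n}/\varepsilon^2$ samples from $p$ and, with probability at least $2/3$, outputs "close" if $d_{\ell_2}(p,q)\le \varepsilon^2/\sqrt n$ and outputs "far" if $d_{\mathrm{H}}(p,q)\ge\varepsilon$.
   Context: For distributions $p,q$ over $[n]$: $d_{\ell_2}(p,q)=\sqrt{\sum_{i=1}^n(p_i-q_i)^2}$ and the Hellinger distance is $d_{\mathrm{H}}(p,q)=\frac{1}{\sqrt 2}\sqrt{\sum_{i=1}^n(\sqrt{p_i}-\sqrt{q_i})^2}$. Identity testing: $q$ is known exactly, $p$ is accessed only through i.i.d. samples. *)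

theory Defs
  imports "HOL-Probability.Probability"
begin

definition distr_on :: "nat \<Rightarrow> nat pmf \<Rightarrow> bool" where
  "distr_on n p \<longleftrightarrow> set_pmf p \<subseteq> {1..n}"

definition l2_dist :: "nat \<Rightarrow> nat pmf \<Rightarrow> nat pmf \<Rightarrow> real" where
  "l2_dist n p q = sqrt (\<Sum>i=1..n. (pmf p i - pmf q i)\<^sup>2)"

definition hellinger_dist :: "nat \<Rightarrow> nat pmf \<Rightarrow> nat pmf \<Rightarrow> real" where
  "hellinger_dist n p q =
     1 / sqrt 2 * sqrt (\<Sum>i=1..n. (sqrt (pmf p i) - sqrt (pmf q i))\<^sup>2)"

datatype verdict = Close | Far

text \<open>
  A (possibly adaptive and randomized) procedure with sample access to an unknown distribution:
  it stops with a verdict, draws a fresh sample and continues depending on its value, or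
  uses internal randomness. The unknown distribution enters only through \<open>run\<close> below,
  so the procedure itself cannot depend on it other than through the samples drawn.
\<close>

datatype procedure =
    Output verdict
  | Draw "nat \<Rightarrow> procedure"
  | Randomize "procedure pmf"

primrec run :: "nat pmf \<Rightarrow> procedure \<Rightarrow> verdict pmf" where
  "run p (Output v) = return_pmf v"
| "run p (Draw k) = bind_pmf p (\<lambda>x. run p (k x))"
| "run p (Randomize c) = join_pmf (map_pmf (run p) c)"

inductive draws_at_most :: "nat \<Rightarrow> procedure \<Rightarrow> bool" where
  "draws_at_most m (Output v)"
| "(\<And>x. draws_at_most m (k x)) \<Longrightarrow> draws_at_most (Suc m) (Draw k)"
| "(\<And>t. t \<in> set_pmf c \<Longrightarrow> draws_at_most m t) \<Longrightarrow> draws_at_most m (Randomize c)"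

end

theory Submission imports Defs begin

text \<open>
  With weights \<open>w\<^sub>i = 1 / max q\<^sub>i (2\<epsilon>\<^sup>2/n)\<close> the quantity \<open>T = \<Sum>\<^sub>i w\<^sub>i (p\<^sub>i - q\<^sub>i)\<^sup>2\<close> is at most \<open>\<epsilon>\<^sup>2/2\<close>
  in the close case and at least \<open>\<epsilon>\<^sup>2\<close> in the far case. Drawing two independent batches of \<open>m\<close>
  samples each with counts \<open>A\<^sub>i\<close> and \<open>B\<^sub>i\<close>, the statistic \<open>Z = \<Sum>\<^sub>i w\<^sub>i (A\<^sub>i - m q\<^sub>i) (B\<^sub>i - m q\<^sub>i)\<close> has
  mean \<open>m\<^sup>2 T\<close>; splitting the samples makes the two factors independent, so no Poissonization
  is needed. Its variance is \<open>O(m\<^sup>2 (m \<Sum>\<^sub>i p\<^sub>i w\<^sub>i\<^sup>2 (p\<^sub>i - q\<^sub>i)\<^sup>2 + \<Sum>\<^sub>i w\<^sub>i\<^sup>2 p\<^sub>i\<^sup>2))\<close>, and Chebyshev's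
  inequality separates the two cases as soon as \<open>m\<close> is a large multiple of \<open>\<surd>n/\<epsilon>\<^sup>2\<close>.
\<close>

section \<open>Moments of i.i.d. samples\<close>

text \<open>Every distribution that occurs has finite support, so integrability is automatic and
  iterated expectations need no further side conditions.\<close>

lemma expectation_bind_pmf_finite:
  fixes h :: "'b \<Rightarrow> real"
  assumes "finite (set_pmf p)" and "\<And>x. x \<in> set_pmf p \<Longrightarrow> finite (set_pmf (f x))"
  shows "measure_pmf.expectation (bind_pmf p f) h =
    measure_pmf.expectation p (\<lambda>x. measure_pmf.expectation (f x) h)"
  using assms
  by (subst pmf_expectation_bind[of "set_pmf p"])
     (auto simp: integral_measure_pmf[of "set_pmf p"])

lemma expectation_pair_pmf_finite:
  fixes h :: "'a \<times> 'b \<Rightarrow> real"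
  assumes "finite (set_pmf p)" and "finite (set_pmf q)"
  shows "measure_pmf.expectation (pair_pmf p q) h =
    measure_pmf.expectation p (\<lambda>x. measure_pmf.expectation q (\<lambda>y. h (x, y)))"
  using assms by (simp add: pair_pmf_def expectation_bind_pmf_finite)

lemma expectation_mono_pmf_finite:
  fixes f g :: "'a \<Rightarrow> real"
  assumes "finite (set_pmf p)" and "\<And>x. x \<in> set_pmf p \<Longrightarrow> f x \<le> g x"
  shows "measure_pmf.expectation p f \<le> measure_pmf.expectation p g"
  using assms
  by (intro integral_mono_AE) (auto simp: integrable_measure_pmf_finite AE_measure_pmf_iff)

lemma finite_set_replicate_pmf:
  "finite (set_pmf p) \<Longrightarrow> finite (set_pmf (replicate_pmf m p))"
  using finite_lists_length_eq[of "set_pmf p" m]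
  by (simp add: set_replicate_pmf lists_eq_set conj_commute)

lemma expectation_replicate_pmf_Suc:
  fixes h :: "'a list \<Rightarrow> real"
  assumes "finite (set_pmf p)"
  shows "measure_pmf.expectation (replicate_pmf (Suc m) p) h =
    measure_pmf.expectation p (\<lambda>x. measure_pmf.expectation (replicate_pmf m p) (\<lambda>xs. h (x # xs)))"
  using assms
  by (simp add: expectation_bind_pmf_finite finite_set_replicate_pmf)

text \<open>Splitting off the first sample \<open>x\<close>, the cross term is
  \<open>2 * g x\<close> times the mean of the remaining sum, which vanishes. Both moments are
  therefore carried through one induction.\<close>

lemma replicate_pmf_sum_list_moments:
  fixes g :: "'a \<Rightarrow> real"
  assumes fin: "finite (set_pmf p)" and g0: "measure_pmf.expectation p g = 0"
  shows "measure_pmf.expectation (replicate_pmf m p) (\<lambda>xs. sum_list (map g xs)) = 0"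
    and "measure_pmf.expectation (replicate_pmf m p) (\<lambda>xs. (sum_list (map g xs))\<^sup>2) =
      real m * measure_pmf.expectation p (\<lambda>x. (g x)\<^sup>2)"
proof (induction m)
  case 0
  { case 1 show ?case by simp }
  { case 2 show ?case by simp }
next
  case (Suc m)
  note [simp] = integrable_measure_pmf_finite[OF fin]
    integrable_measure_pmf_finite[OF finite_set_replicate_pmf[OF fin]]
  {
    case 1
    show ?case
      using Suc.IH(1) g0 by (simp add: expectation_replicate_pmf_Suc[OF fin] del: replicate_pmf.simps)
  next
    case 2
    have "measure_pmf.expectation (replicate_pmf m p) (\<lambda>xs. (sum_list (map g (x # xs)))\<^sup>2) =
        (g x)\<^sup>2 + real m * measure_pmf.expectation p (\<lambda>x. (g x)\<^sup>2)" for x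
      using Suc.IH by (simp add: power2_sum)
    then show ?case
      by (simp add: expectation_replicate_pmf_Suc[OF fin] algebra_simps del: replicate_pmf.simps)
  }
qed

text \<open>The reference distribution need not be the one that produced \<open>xs\<close>. With the
  sampling distribution the deviation is centred; with the known \<open>q\<close> it is a quantity
  that the tester can compute.\<close>

definition count_dev :: "nat \<Rightarrow> 'a pmf \<Rightarrow> 'a list \<Rightarrow> 'a \<Rightarrow> real" where
  "count_dev m p xs i = real (count_list xs i) - real m * pmf p i"

text \<open>Regrouping the counts sample by sample turns a linear form in them into a sum of i.i.d.
  centred terms. Membership of \<open>xs\<close> in the support supplies the length \<open>m\<close>
  needed for the centring.\<close>

lemma sum_count_dev:
  assumes "finite I" and "set_pmf p \<subseteq> I" and "xs \<in> set_pmf (replicate_pmf m p)"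
  shows "(\<Sum>i\<in>I. g i * count_dev m p xs i) =
    sum_list (map (\<lambda>x. g x - measure_pmf.expectation p g) xs)"
proof -
  have xs: "set xs \<subseteq> I" "length xs = m"
    using assms by (auto simp: set_replicate_pmf)
  have "(\<Sum>i\<in>I. g i * real (count_list xs i)) = sum_list (map g xs)"
    using xs(1)
  proof (induction xs)
    case (Cons x xs)
    then have "(\<Sum>i\<in>I. g i * real (count_list (x # xs) i)) =
        (\<Sum>i\<in>I. g i * real (count_list xs i) + (if x = i then g i else 0))"
      by (intro sum.cong) (auto simp: algebra_simps)
    also have "\<dots> = g x + sum_list (map g xs)"
      using Cons assms(1) by (simp add: sum.distrib)
    finally show ?case by simp
  qed simp
  moreover have "measure_pmf.expectation p g = (\<Sum>i\<in>I. g i * pmf p i)"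
    using assms by (intro integral_measure_pmf_real) auto
  ultimately show ?thesis
    using xs(2)
    by (simp add: count_dev_def sum_list_subtractf right_diff_distrib sum_subtractf
        sum_distrib_left sum_list_triv algebra_simps)
qed

text \<open>The left side equals \<open>m\<close> times the variance of \<open>g\<close>; discarding
  the squared mean gives the bound. Passing through the samples avoids the covariances of the
  multinomial counts.\<close>

lemma expectation_sum_count_dev_sq:
  assumes I: "finite I" "set_pmf p \<subseteq> I"
  shows "measure_pmf.expectation (replicate_pmf m p) (\<lambda>xs. (\<Sum>i\<in>I. g i * count_dev m p xs i)\<^sup>2)
    \<le> real m * (\<Sum>i\<in>I. pmf p i * (g i)\<^sup>2)"
proof -
  have fin: "finite (set_pmf p)"
    using I finite_subset by blast
  note [simp] = integrable_measure_pmf_finite[OF fin]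
  define e where "e = measure_pmf.expectation p g"
  have "measure_pmf.expectation (replicate_pmf m p) (\<lambda>xs. (\<Sum>i\<in>I. g i * count_dev m p xs i)\<^sup>2) =
      measure_pmf.expectation (replicate_pmf m p) (\<lambda>xs. (sum_list (map (\<lambda>x. g x - e) xs))\<^sup>2)"
    by (intro integral_cong_AE) (auto simp: AE_measure_pmf_iff sum_count_dev[OF I] e_def)
  also have "\<dots> = real m * measure_pmf.expectation p (\<lambda>x. (g x - e)\<^sup>2)"
    by (intro replicate_pmf_sum_list_moments fin) (simp add: e_def)
  also have "measure_pmf.expectation p (\<lambda>x. (g x - e)\<^sup>2) =
      measure_pmf.expectation p (\<lambda>x. (g x)\<^sup>2) - e\<^sup>2"
    by (simp add: power2_diff e_def[symmetric]) (simp add: power2_eq_square)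
  also have "\<dots> \<le> (\<Sum>i\<in>I. pmf p i * (g i)\<^sup>2)"
    using I by (subst integral_measure_pmf_real[of I]) (auto simp: mult.commute)
  finally show ?thesis
    by (simp add: mult_left_mono)
qed

lemma expectation_count_dev_sq:
  assumes "finite I" "set_pmf p \<subseteq> I" "i \<in> I"
  shows "measure_pmf.expectation (replicate_pmf m p) (\<lambda>xs. (count_dev m p xs i)\<^sup>2) \<le> real m * pmf p i"
proof -
  have "(\<Sum>j\<in>I. (if j = i then 1 else 0) * count_dev m p xs j) = count_dev m p xs i" for xs
    using assms by (simp add: if_distrib[of "\<lambda>x. x * _"] cong: if_cong)
  moreover have "(\<Sum>j\<in>I. pmf p j * (if j = i then 1 else 0)\<^sup>2) = pmf p i"
    using assms by (simp add: if_distrib[of "\<lambda>x. x\<^sup>2"] if_distrib[of "\<lambda>x. _ * x"] cong: if_cong)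
  ultimately show ?thesis
    using expectation_sum_count_dev_sq[OF assms(1,2), of m "\<lambda>j. if j = i then 1 else 0"] by simp
qed

text \<open>For fixed \<open>xs\<close> the form is linear in the deviations of \<open>ys\<close>,
  with coefficients \<open>w i * count_dev m p xs i\<close>. Apply the linear bound to
  \<open>ys\<close>, then the bound for a single count to \<open>xs\<close>.\<close>

lemma expectation_bilinear_count_dev_sq:
  assumes I: "finite I" "set_pmf p \<subseteq> I"
  shows "measure_pmf.expectation (pair_pmf (replicate_pmf m p) (replicate_pmf m p))
      (\<lambda>(xs, ys). (\<Sum>i\<in>I. w i * count_dev m p xs i * count_dev m p ys i)\<^sup>2)
    \<le> (real m)\<^sup>2 * (\<Sum>i\<in>I. (w i)\<^sup>2 * (pmf p i)\<^sup>2)"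
proof -
  let ?R = "replicate_pmf m p"
  have fin: "finite (set_pmf ?R)"
    using I finite_subset finite_set_replicate_pmf by blast
  note [simp] = integrable_measure_pmf_finite[OF fin]
  have "measure_pmf.expectation (pair_pmf ?R ?R)
      (\<lambda>(xs, ys). (\<Sum>i\<in>I. w i * count_dev m p xs i * count_dev m p ys i)\<^sup>2) =
      measure_pmf.expectation ?R (\<lambda>xs. measure_pmf.expectation ?R
        (\<lambda>ys. (\<Sum>i\<in>I. w i * count_dev m p xs i * count_dev m p ys i)\<^sup>2))"
    by (simp add: expectation_pair_pmf_finite fin)
  also have "\<dots> \<le> measure_pmf.expectation ?R
      (\<lambda>xs. real m * (\<Sum>i\<in>I. pmf p i * (w i * count_dev m p xs i)\<^sup>2))"
    by (intro expectation_mono_pmf_finite fin expectation_sum_count_dev_sq I)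
  also have "\<dots> = real m * (\<Sum>i\<in>I. pmf p i * (w i)\<^sup>2 *
      measure_pmf.expectation ?R (\<lambda>xs. (count_dev m p xs i)\<^sup>2))"
    by (simp add: power_mult_distrib mult.assoc)
  also have "\<dots> \<le> real m * (\<Sum>i\<in>I. pmf p i * (w i)\<^sup>2 * (real m * pmf p i))"
    by (intro mult_left_mono sum_mono expectation_count_dev_sq[OF I]) auto
  also have "\<dots> = (real m)\<^sup>2 * (\<Sum>i\<in>I. (w i)\<^sup>2 * (pmf p i)\<^sup>2)"
    by (simp add: sum_distrib_left power2_eq_square algebra_simps)
  finally show ?thesis .
qed

section \<open>The test statistic\<close>

definition stat :: "'a set \<Rightarrow> ('a \<Rightarrow> real) \<Rightarrow> nat \<Rightarrow> 'a pmf \<Rightarrow> 'a list \<Rightarrow> 'a list \<Rightarrow> real" where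
  "stat I w m q xs ys = (\<Sum>i\<in>I. w i * count_dev m q xs i * count_dev m q ys i)"

lemma sum3_sq_le: "((a::real) + b + c)\<^sup>2 \<le> 3 * (a\<^sup>2 + b\<^sup>2 + c\<^sup>2)"
proof -
  have "0 \<le> (a - b)\<^sup>2 + (b - c)\<^sup>2 + (a - c)\<^sup>2"
    by simp
  then show ?thesis
    by (simp add: power2_eq_square algebra_simps)
qed

text \<open>Deviations from \<open>q\<close> are deviations from \<open>p\<close> shifted by
  \<open>m * \<mu> i\<close>. Expanding the product leaves the mean, one linear term per batch and
  one bilinear term. The inequality for the square of three summands costs a factor 3 and spares the
  computation of cross terms.\<close>

lemma stat_second_moment:
  fixes p q :: "'a pmf" and w :: "'a \<Rightarrow> real"
  assumes I: "finite I" "set_pmf p \<subseteq> I"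
  defines "\<mu> \<equiv> \<lambda>i. pmf p i - pmf q i"
  shows "measure_pmf.expectation (pair_pmf (replicate_pmf m p) (replicate_pmf m p))
      (\<lambda>(xs, ys). (stat I w m q xs ys - (real m)\<^sup>2 * (\<Sum>i\<in>I. w i * (\<mu> i)\<^sup>2))\<^sup>2)
    \<le> 3 * (real m)\<^sup>2 *
        (2 * real m * (\<Sum>i\<in>I. pmf p i * (w i * \<mu> i)\<^sup>2) + (\<Sum>i\<in>I. (w i)\<^sup>2 * (pmf p i)\<^sup>2))"
proof -
  let ?R = "replicate_pmf m p"
  let ?P = "pair_pmf ?R ?R"
  have fin: "finite (set_pmf ?R)"
    using I finite_subset finite_set_replicate_pmf by blast
  then have finP: "finite (set_pmf ?P)"
    by simp
  note [simp] = integrable_measure_pmf_finite[OF finP]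
  define L where "L = (\<lambda>xs. \<Sum>i\<in>I. (w i * \<mu> i) * count_dev m p xs i)"
  define B where "B = (\<lambda>xs ys. \<Sum>i\<in>I. w i * count_dev m p xs i * count_dev m p ys i)"
  define V where "V = (\<Sum>i\<in>I. pmf p i * (w i * \<mu> i)\<^sup>2)"
  define W where "W = (\<Sum>i\<in>I. (w i)\<^sup>2 * (pmf p i)\<^sup>2)"
  have dev: "count_dev m q xs i = count_dev m p xs i + real m * \<mu> i" for xs i
    by (simp add: count_dev_def \<mu>_def algebra_simps)
  have dec: "stat I w m q xs ys - (real m)\<^sup>2 * (\<Sum>i\<in>I. w i * (\<mu> i)\<^sup>2) =
      real m * L xs + real m * L ys + B xs ys" for xs ys
    by (simp add: stat_def dev L_def B_def sum_distrib_left power2_eq_square algebra_simps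
        flip: sum.distrib sum_subtractf)
  have L: "measure_pmf.expectation ?R (\<lambda>xs. (L xs)\<^sup>2) \<le> real m * V"
    unfolding L_def V_def by (rule expectation_sum_count_dev_sq[OF I])
  have B: "measure_pmf.expectation ?P (\<lambda>z. (B (fst z) (snd z))\<^sup>2) \<le> (real m)\<^sup>2 * W"
    using expectation_bilinear_count_dev_sq[OF I, of m w]
    by (simp add: B_def W_def case_prod_unfold)
  have "measure_pmf.expectation ?P
      (\<lambda>(xs, ys). (stat I w m q xs ys - (real m)\<^sup>2 * (\<Sum>i\<in>I. w i * (\<mu> i)\<^sup>2))\<^sup>2)
    \<le> measure_pmf.expectation ?P (\<lambda>z. 3 * ((real m)\<^sup>2 * (L (fst z))\<^sup>2 +
        (real m)\<^sup>2 * (L (snd z))\<^sup>2 + (B (fst z) (snd z))\<^sup>2))"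
    unfolding dec
    by (intro expectation_mono_pmf_finite finP)
       (auto intro!: order.trans[OF sum3_sq_le] simp: power_mult_distrib)
  also have "\<dots> = 3 * ((real m)\<^sup>2 * measure_pmf.expectation ?R (\<lambda>xs. (L xs)\<^sup>2) +
      (real m)\<^sup>2 * measure_pmf.expectation ?R (\<lambda>xs. (L xs)\<^sup>2) +
      measure_pmf.expectation ?P (\<lambda>z. (B (fst z) (snd z))\<^sup>2))"
    by (simp add: expectation_pair_pmf_fst[where f = "\<lambda>xs. (L xs)\<^sup>2"]
        expectation_pair_pmf_snd[where f = "\<lambda>xs. (L xs)\<^sup>2"])
  also have "\<dots> \<le> 3 * ((real m)\<^sup>2 * (real m * V) + (real m)\<^sup>2 * (real m * V) + (real m)\<^sup>2 * W)"
    by (intro mult_left_mono add_mono L B) auto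
  finally show ?thesis
    by (simp add: V_def W_def algebra_simps)
qed

text \<open>Chebyshev's inequality: the indicator of the event is dominated pointwise by
  \<open>(D z)^2 / a^2\<close>.\<close>

lemma prob_abs_ge_le_second_moment:
  fixes D :: "'a \<Rightarrow> real"
  assumes "finite (set_pmf P)" and "a > 0"
  shows "measure_pmf.prob P {z. a \<le> \<bar>D z\<bar>} \<le> measure_pmf.expectation P (\<lambda>z. (D z)\<^sup>2) / a\<^sup>2"
proof -
  have "measure_pmf.prob P {z. a \<le> \<bar>D z\<bar>} =
      measure_pmf.expectation P (indicator {z. a \<le> \<bar>D z\<bar>})"
    by simp
  also have "\<dots> \<le> measure_pmf.expectation P (\<lambda>z. (D z)\<^sup>2 / a\<^sup>2)"
    using assms abs_le_square_iff[of a]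
    by (intro expectation_mono_pmf_finite) (auto simp: indicator_def)
  finally show ?thesis by simp
qed

section \<open>Separation by the weighted distance\<close>

text \<open>This is the chi-square weight \<open>1 / q i\<close>, truncated so that elements of
  small or zero mass cannot dominate. The floors add up to \<open>2 * \<epsilon>^2\<close> over the
  domain, which fixes the loss in the Hellinger comparison.\<close>

definition weight :: "nat \<Rightarrow> real \<Rightarrow> nat pmf \<Rightarrow> nat \<Rightarrow> real" where
  "weight n \<epsilon> q i = 1 / max (pmf q i) (2 * \<epsilon>\<^sup>2 / real n)"

lemma weight_bounds:
  assumes "n \<ge> 1" and "\<epsilon> > 0"
  shows "weight n \<epsilon> q i > 0" and "weight n \<epsilon> q i \<le> real n / (2 * \<epsilon>\<^sup>2)"
    and "weight n \<epsilon> q i * pmf q i \<le> 1"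
proof -
  have \<tau>: "2 * \<epsilon>\<^sup>2 / real n > 0"
    using assms by simp
  then have pos: "max (pmf q i) (2 * \<epsilon>\<^sup>2 / real n) > 0"
    by linarith
  then show "weight n \<epsilon> q i > 0"
    by (simp add: weight_def)
  have "weight n \<epsilon> q i \<le> 1 / (2 * \<epsilon>\<^sup>2 / real n)"
    unfolding weight_def by (rule frac_le) (use \<tau> in auto)
  then show "weight n \<epsilon> q i \<le> real n / (2 * \<epsilon>\<^sup>2)"
    by simp
  show "weight n \<epsilon> q i * pmf q i \<le> 1"
    using pos by (simp add: weight_def divide_le_eq)
qed

lemma sqrt_diff_sq_le_abs_diff:
  assumes "a \<ge> 0" and "b \<ge> 0"
  shows "(sqrt a - sqrt b)\<^sup>2 \<le> \<bar>a - b\<bar>"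
proof -
  have "\<bar>sqrt a - sqrt b\<bar> * \<bar>sqrt a - sqrt b\<bar> \<le> \<bar>sqrt a - sqrt b\<bar> * \<bar>sqrt a + sqrt b\<bar>"
    using assms by (intro mult_left_mono) (auto simp: abs_le_iff)
  also have "\<dots> = \<bar>a - b\<bar>"
    unfolding abs_mult[symmetric] using assms by (simp add: algebra_simps)
  finally show ?thesis
    by (simp add: power2_eq_square)
qed

text \<open>For large \<open>b\<close>, factor \<open>a - b\<close> into the difference and the sum
  of the roots, the latter being at least \<open>sqrt b\<close>. For small \<open>b\<close>, bound
  the left side by \<open>\<bar>a - b\<bar>\<close> and compare this with its square at scale
  \<open>\<tau>\<close>.\<close>

lemma sqrt_diff_sq_le_weighted:
  assumes "a \<ge> 0" and "b \<ge> 0" and "\<tau> > (0::real)"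
  shows "(sqrt a - sqrt b)\<^sup>2 \<le> (a - b)\<^sup>2 / max b \<tau> + \<tau> / 2"
proof (cases "b \<ge> \<tau>")
  case True
  have "(sqrt a - sqrt b)\<^sup>2 * b = (sqrt a - sqrt b)\<^sup>2 * (sqrt b)\<^sup>2"
    using assms by simp
  also have "\<dots> \<le> (sqrt a - sqrt b)\<^sup>2 * (sqrt a + sqrt b)\<^sup>2"
    using assms by (intro mult_left_mono power_mono) auto
  also have "\<dots> = (a - b)\<^sup>2"
    using assms by (simp add: algebra_simps flip: power_mult_distrib)
  finally have "(sqrt a - sqrt b)\<^sup>2 \<le> (a - b)\<^sup>2 / b"
    using True assms by (simp add: le_divide_eq)
  then show ?thesis
    using True assms by (simp add: max_def)
next
  case False
  define t where "t = \<bar>a - b\<bar>"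
  \<comment> \<open>Completing the square alone would give the error \<open>\<tau> / 4\<close>; the
    added \<open>\<tau>^2 / 4\<close> turns it into the stated \<open>\<tau> / 2\<close>.\<close>
  have "0 \<le> (t - \<tau> / 2)\<^sup>2 + \<tau>\<^sup>2 / 4"
    by simp
  also have "\<dots> = t\<^sup>2 + \<tau> / 2 * \<tau> - t * \<tau>"
    by (simp add: power2_eq_square algebra_simps)
  finally have "t \<le> t\<^sup>2 / \<tau> + \<tau> / 2"
    using assms by (simp add: field_simps power2_eq_square)
  moreover have "t\<^sup>2 = (a - b)\<^sup>2"
    by (simp add: t_def)
  ultimately show ?thesis
    using False sqrt_diff_sq_le_abs_diff[OF assms(1,2)] by (simp add: t_def max_def)
qed

text \<open>The largest possible weight \<open>n / (2 * \<epsilon>^2)\<close> meets a squared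
  distance of at most \<open>\<epsilon>^4 / n\<close>.\<close>

lemma weighted_dist_close:
  assumes "n \<ge> 1" and "\<epsilon> > 0" and "l2_dist n p q \<le> \<epsilon>\<^sup>2 / sqrt (real n)"
  shows "(\<Sum>i=1..n. weight n \<epsilon> q i * (pmf p i - pmf q i)\<^sup>2) \<le> \<epsilon>\<^sup>2 / 2"
proof -
  have "(l2_dist n p q)\<^sup>2 \<le> (\<epsilon>\<^sup>2 / sqrt (real n))\<^sup>2"
    using assms by (intro power_mono) (auto simp: l2_dist_def sum_nonneg)
  then have l2: "(\<Sum>i=1..n. (pmf p i - pmf q i)\<^sup>2) \<le> \<epsilon> ^ 4 / real n"
    by (simp add: l2_dist_def sum_nonneg power_divide)
  have "(\<Sum>i=1..n. weight n \<epsilon> q i * (pmf p i - pmf q i)\<^sup>2) \<le>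
      (\<Sum>i=1..n. real n / (2 * \<epsilon>\<^sup>2) * (pmf p i - pmf q i)\<^sup>2)"
    by (intro sum_mono mult_right_mono weight_bounds assms) auto
  also have "\<dots> \<le> real n / (2 * \<epsilon>\<^sup>2) * (\<epsilon> ^ 4 / real n)"
    unfolding sum_distrib_left[symmetric] by (intro mult_left_mono l2) auto
  also have "\<dots> = \<epsilon>\<^sup>2 / 2"
    using assms by (simp add: field_simps power_numeral_reduce)
  finally show ?thesis .
qed

lemma hellinger_dist_sq:
  "(hellinger_dist n p q)\<^sup>2 = (\<Sum>i=1..n. (sqrt (pmf p i) - sqrt (pmf q i))\<^sup>2) / 2"
  by (simp add: hellinger_dist_def power_divide sum_nonneg)

text \<open>The squared differences of roots sum to at least \<open>2 * \<epsilon>^2\<close>, and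
  the \<open>n\<close> truncation errors \<open>\<tau> / 2\<close> with
  \<open>\<tau> = 2 * \<epsilon>^2 / n\<close> use up only \<open>\<epsilon>^2\<close> of
  it.\<close>

lemma weighted_dist_far:
  assumes "n \<ge> 1" and "\<epsilon> > 0" and "hellinger_dist n p q \<ge> \<epsilon>"
  shows "\<epsilon>\<^sup>2 \<le> (\<Sum>i=1..n. weight n \<epsilon> q i * (pmf p i - pmf q i)\<^sup>2)"
proof -
  have "\<epsilon>\<^sup>2 \<le> (hellinger_dist n p q)\<^sup>2"
    using assms by (intro power_mono) auto
  then have "2 * \<epsilon>\<^sup>2 \<le> (\<Sum>i=1..n. (sqrt (pmf p i) - sqrt (pmf q i))\<^sup>2)"
    by (simp add: hellinger_dist_sq)
  also have "\<dots> \<le> (\<Sum>i=1..n. weight n \<epsilon> q i * (pmf p i - pmf q i)\<^sup>2 + (2 * \<epsilon>\<^sup>2 / real n) / 2)"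
    using sqrt_diff_sq_le_weighted[of _ _ "2 * \<epsilon>\<^sup>2 / real n"] assms
    by (intro sum_mono) (simp add: weight_def)
  also have "\<dots> = (\<Sum>i=1..n. weight n \<epsilon> q i * (pmf p i - pmf q i)\<^sup>2) + \<epsilon>\<^sup>2"
    using assms by (simp add: sum.distrib)
  finally show ?thesis by simp
qed

text \<open>Consequently the far case can occur only for \<epsilon> at most 1.\<close>

lemma hellinger_dist_le_1:
  assumes "distr_on n p" and "distr_on n q"
  shows "hellinger_dist n p q \<le> 1"
proof -
  have "(\<Sum>i=1..n. (sqrt (pmf p i) - sqrt (pmf q i))\<^sup>2) \<le> (\<Sum>i=1..n. pmf p i + pmf q i)"
    by (intro sum_mono) (simp add: power2_diff)
  also have "\<dots> = 2"
    using assms by (simp add: sum.distrib distr_on_def sum_pmf_eq_1)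
  finally have "(hellinger_dist n p q)\<^sup>2 \<le> 1\<^sup>2"
    by (simp add: hellinger_dist_sq)
  then show ?thesis
    by (rule power2_le_imp_le) simp
qed

section \<open>Variance and concentration of the statistic\<close>

text \<open>The scale \<open>M\<close> serves both cases: it will be \<open>\<epsilon>^2\<close> in
  the close case and the weighted distance itself in the far case. All quantities are measured in
  \<open>s = sqrt n / \<epsilon>^2\<close>, so that \<open>n\<close> becomes
  \<open>s^2 * \<epsilon>^4\<close> and is at most \<open>s^2 * M^2\<close>.\<close>

lemma weighted_variance_bound:
  fixes p q :: "nat pmf" and m :: nat
  assumes n: "n \<ge> 1" and \<epsilon>: "\<epsilon> > 0" and m: "1152 * sqrt (real n) / \<epsilon>\<^sup>2 \<le> real m"
  defines "w \<equiv> weight n \<epsilon> q" and "\<mu> \<equiv> \<lambda>i. pmf p i - pmf q i"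
  assumes T: "(\<Sum>i=1..n. w i * (\<mu> i)\<^sup>2) \<le> M" and M: "\<epsilon>\<^sup>2 \<le> M"
  shows "144 * (2 * real m * (\<Sum>i=1..n. pmf p i * (w i * \<mu> i)\<^sup>2) +
      (\<Sum>i=1..n. (w i)\<^sup>2 * (pmf p i)\<^sup>2)) \<le> (real m)\<^sup>2 * M\<^sup>2"
proof -
  define s where "s = sqrt (real n) / \<epsilon>\<^sup>2"
  have s0: "s > 0" using n \<epsilon> by (simp add: s_def)
  have s2: "s\<^sup>2 * \<epsilon>\<^sup>2 * \<epsilon>\<^sup>2 = real n"
  proof -
    have "s * \<epsilon>\<^sup>2 = sqrt (real n)"
      using \<epsilon> by (simp add: s_def)
    then have "(s * \<epsilon>\<^sup>2)\<^sup>2 = real n"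
      by simp
    then show ?thesis
      by (simp only: power2_eq_square mult_ac)
  qed
  have M0: "M > 0" using M \<epsilon> by (smt (verit) zero_less_power)
  have sM: "1 \<le> s * M"
  proof -
    have "1 \<le> s * \<epsilon>\<^sup>2" using n \<epsilon> by (simp add: s_def)
    also have "\<dots> \<le> s * M" using M s0 by simp
    finally show ?thesis .
  qed
  have wmax: "w i \<le> s\<^sup>2 * M / 2" for i
  proof -
    have "w i \<le> real n / (2 * \<epsilon>\<^sup>2)"
      using weight_bounds[OF n \<epsilon>] by (simp add: w_def)
    also have "\<dots> = s\<^sup>2 * \<epsilon>\<^sup>2 / 2"
      using \<epsilon> by (simp flip: s2)
    also have "\<dots> \<le> s\<^sup>2 * M / 2"
      using M by (simp add: mult_left_mono)
    finally show ?thesis .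
  qed
  have w0: "w i > 0" and wq: "w i * pmf q i \<le> 1" for i
    using weight_bounds[OF n \<epsilon>] by (simp_all add: w_def)
  \<comment> \<open>A single summand \<open>w i * (\<mu> i)^2\<close> is at most \<open>M\<close>;
    one more weight, bounded by \<open>wmax\<close>, gives the square of
    \<open>w i * \<mu> i\<close>.\<close>
  have w\<mu>: "\<bar>w i * \<mu> i\<bar> \<le> s * M" if "i \<in> {1..n}" for i
  proof -
    have "w i * (\<mu> i)\<^sup>2 \<le> (\<Sum>i=1..n. w i * (\<mu> i)\<^sup>2)"
      using that by (intro member_le_sum) (auto intro!: mult_nonneg_nonneg less_imp_le[OF w0])
    then have "w i * (w i * (\<mu> i)\<^sup>2) \<le> (s\<^sup>2 * M / 2) * M"
      using T wmax[of i] w0[of i] M0 by (intro mult_mono) auto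
    also have "\<dots> \<le> (s * M)\<^sup>2"
      using M0 by (simp add: power2_eq_square)
    finally have "(w i * \<mu> i)\<^sup>2 \<le> (s * M)\<^sup>2"
      by (simp add: power2_eq_square algebra_simps)
    then show ?thesis
      using s0 M0 by (simp add: abs_le_square_iff[symmetric])
  qed
  have wp: "w i * pmf p i \<le> 2 * (s * M)" if "i \<in> {1..n}" for i
  proof -
    have "w i * pmf p i = w i * pmf q i + w i * \<mu> i"
      by (simp add: \<mu>_def algebra_simps)
    then show ?thesis
      using wq[of i] w\<mu>[OF that] sM by linarith
  qed
  \<comment> \<open>One factor \<open>w i * pmf p i\<close> is bounded pointwise by
    \<open>wp\<close>; what remains sums to at most \<open>M\<close>.\<close>
  have V: "(\<Sum>i=1..n. pmf p i * (w i * \<mu> i)\<^sup>2) \<le> 2 * s * M\<^sup>2"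
  proof -
    have "(\<Sum>i=1..n. pmf p i * (w i * \<mu> i)\<^sup>2) = (\<Sum>i=1..n. (w i * pmf p i) * (w i * (\<mu> i)\<^sup>2))"
      by (simp add: power2_eq_square algebra_simps)
    also have "\<dots> \<le> (\<Sum>i=1..n. 2 * (s * M) * (w i * (\<mu> i)\<^sup>2))"
      by (intro sum_mono mult_right_mono wp) (auto intro!: mult_nonneg_nonneg less_imp_le[OF w0])
    also have "\<dots> \<le> 2 * (s * M) * M"
      unfolding sum_distrib_left[symmetric] using T s0 M0 by (intro mult_left_mono) auto
    finally show ?thesis
      by (simp add: power2_eq_square algebra_simps)
  qed
  \<comment> \<open>Write \<open>p = q + \<mu>\<close>: the \<open>q\<close> part contributes at
    most 2 per element, hence \<open>2 * n\<close> in total, and in the \<open>\<mu>\<close> part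
    one weight is replaced by its maximum.\<close>
  have W: "(\<Sum>i=1..n. (w i)\<^sup>2 * (pmf p i)\<^sup>2) \<le> 3 * s\<^sup>2 * M\<^sup>2"
  proof -
    have "(w i)\<^sup>2 * (pmf p i)\<^sup>2 \<le> 2 + s\<^sup>2 * M * (w i * (\<mu> i)\<^sup>2)" for i
    proof -
      have "(w i)\<^sup>2 * (pmf p i)\<^sup>2 = (w i * pmf q i + w i * \<mu> i)\<^sup>2"
        by (simp add: \<mu>_def algebra_simps flip: power_mult_distrib)
      also have "\<dots> \<le> 2 * (w i * pmf q i)\<^sup>2 + 2 * (w i * \<mu> i)\<^sup>2"
        using sum_squares_bound[of "w i * pmf q i" "w i * \<mu> i"] by (simp add: power2_sum)
      also have "\<dots> \<le> 2 + 2 * (w i * \<mu> i)\<^sup>2"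
        using wq[of i] w0[of i] by (simp add: power_le_one)
      also have "2 * (w i * \<mu> i)\<^sup>2 = 2 * w i * (w i * (\<mu> i)\<^sup>2)"
        by (simp add: power2_eq_square algebra_simps)
      also have "\<dots> \<le> s\<^sup>2 * M * (w i * (\<mu> i)\<^sup>2)"
        using wmax[of i] w0[of i] by (intro mult_right_mono) auto
      finally show ?thesis by simp
    qed
    then have "(\<Sum>i=1..n. (w i)\<^sup>2 * (pmf p i)\<^sup>2) \<le> (\<Sum>i=1..n. 2 + s\<^sup>2 * M * (w i * (\<mu> i)\<^sup>2))"
      by (intro sum_mono)
    also have "\<dots> = 2 * real n + s\<^sup>2 * M * (\<Sum>i=1..n. w i * (\<mu> i)\<^sup>2)"
      by (simp add: sum.distrib sum_distrib_left)
    also have "\<dots> \<le> 2 * (s\<^sup>2 * M * M) + s\<^sup>2 * M * M"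
      unfolding s2[symmetric] using T M M0 by (intro add_mono mult_left_mono mult_mono) auto
    finally show ?thesis
      by (simp add: power2_eq_square algebra_simps)
  qed
  have ms: "1152 * s \<le> real m"
    using m by (simp add: s_def)
  have "144 * (2 * real m * (\<Sum>i=1..n. pmf p i * (w i * \<mu> i)\<^sup>2) +
      (\<Sum>i=1..n. (w i)\<^sup>2 * (pmf p i)\<^sup>2)) \<le> 144 * (2 * real m * (2 * s * M\<^sup>2) + 3 * s\<^sup>2 * M\<^sup>2)"
    by (intro mult_left_mono add_mono V W) auto
  also have "\<dots> = (576 * real m * s + 432 * s\<^sup>2) * M\<^sup>2"
    by (simp add: algebra_simps)
  also have "\<dots> \<le> (real m)\<^sup>2 * M\<^sup>2"
  \<comment> \<open>Since \<open>1152 = 2 * 576\<close>, the term linear in \<open>m\<close> takes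
    half of \<open>m^2\<close>; the term in \<open>s^2\<close> fits easily into the other
    half.\<close>
  proof (intro mult_right_mono)
    have "real m * (1152 * s) \<le> real m * real m" "(1152 * s) * (1152 * s) \<le> real m * real m"
      using ms s0 by (intro mult_left_mono mult_mono; simp)+
    moreover have "s * s \<ge> 0" by simp
    ultimately show "576 * real m * s + 432 * s\<^sup>2 \<le> (real m)\<^sup>2"
      unfolding power2_eq_square by linarith
  qed simp
  finally show ?thesis .
qed

lemma stat_concentration:
  fixes p q :: "nat pmf" and m :: nat
  assumes n: "n \<ge> 1" and \<epsilon>: "\<epsilon> > 0" and m: "1152 * sqrt (real n) / \<epsilon>\<^sup>2 \<le> real m"
    and p: "distr_on n p"
  defines "w \<equiv> weight n \<epsilon> q"
  defines "T \<equiv> \<Sum>i=1..n. w i * (pmf p i - pmf q i)\<^sup>2"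
  assumes T: "T \<le> M" and M: "\<epsilon>\<^sup>2 \<le> M"
  shows "measure_pmf.prob (pair_pmf (replicate_pmf m p) (replicate_pmf m p))
    {z. (real m)\<^sup>2 * M / 4 \<le> \<bar>stat {1..n} w m q (fst z) (snd z) - (real m)\<^sup>2 * T\<bar>} \<le> 1 / 3"
proof -
  let ?P = "pair_pmf (replicate_pmf m p) (replicate_pmf m p)"
  have I: "finite {1..n}" "set_pmf p \<subseteq> {1..n}"
    using p by (auto simp: distr_on_def)
  have fin: "finite (set_pmf ?P)"
    using finite_set_replicate_pmf[OF finite_subset[OF I(2,1)]] by simp
  have M0: "M > 0"
    using M \<epsilon> by (smt (verit) zero_less_power)
  have "real m > 0"
    by (rule less_le_trans[OF _ m]) (use n \<epsilon> in auto)
  then have a: "(real m)\<^sup>2 * M / 4 > 0"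
    using M0 by simp
  define Q where "Q = 2 * real m * (\<Sum>i=1..n. pmf p i * (w i * (pmf p i - pmf q i))\<^sup>2) +
      (\<Sum>i=1..n. (w i)\<^sup>2 * (pmf p i)\<^sup>2)"
  have "144 * Q \<le> (real m)\<^sup>2 * M\<^sup>2"
    using weighted_variance_bound[OF n \<epsilon> m _ M] T by (simp add: Q_def w_def T_def)
  then have "(real m)\<^sup>2 * (144 * Q) \<le> (real m)\<^sup>2 * ((real m)\<^sup>2 * M\<^sup>2)"
    by (intro mult_left_mono) auto
  \<comment> \<open>Here \<open>144 = 3 * 4^2 * 3\<close>: the factor of the second-moment bound,
    the squared denominator of the deviation, and the failure probability 1/3.\<close>
  then have Q: "3 * (real m)\<^sup>2 * Q \<le> ((real m)\<^sup>2 * M / 4)\<^sup>2 / 3"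
    by (simp add: power2_eq_square algebra_simps)
  have "measure_pmf.prob ?P
      {z. (real m)\<^sup>2 * M / 4 \<le> \<bar>stat {1..n} w m q (fst z) (snd z) - (real m)\<^sup>2 * T\<bar>} \<le>
      measure_pmf.expectation ?P
        (\<lambda>z. (stat {1..n} w m q (fst z) (snd z) - (real m)\<^sup>2 * T)\<^sup>2) / ((real m)\<^sup>2 * M / 4)\<^sup>2"
    by (rule prob_abs_ge_le_second_moment[OF fin a])
  also have "\<dots> \<le> (3 * (real m)\<^sup>2 * Q) / ((real m)\<^sup>2 * M / 4)\<^sup>2"
    using stat_second_moment[OF I, of m w q]
    by (intro divide_right_mono) (auto simp: T_def Q_def case_prod_unfold)
  also have "\<dots> \<le> (((real m)\<^sup>2 * M / 4)\<^sup>2 / 3) / ((real m)\<^sup>2 * M / 4)\<^sup>2"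
    by (intro divide_right_mono Q) auto
  also have "\<dots> = 1 / 3"
    using \<open>real m > 0\<close> M0 by simp
  finally show ?thesis .
qed

section \<open>The tester\<close>

text \<open>The continuation \<open>k\<close> receives the whole batch, so that two batches are
  drawn by nesting.\<close>

primrec draw_list :: "nat \<Rightarrow> (nat list \<Rightarrow> procedure) \<Rightarrow> procedure" where
  "draw_list 0 k = k []"
| "draw_list (Suc m) k = Draw (\<lambda>x. draw_list m (\<lambda>xs. k (x # xs)))"

lemma run_draw_list:
  "run p (draw_list m k) = bind_pmf (replicate_pmf m p) (\<lambda>xs. run p (k xs))"
  by (induction m arbitrary: k) (simp_all add: bind_return_pmf bind_assoc_pmf)

lemma draws_at_most_draw_list:
  assumes "\<And>xs. draws_at_most l (k xs)"
  shows "draws_at_most (m + l) (draw_list m k)"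
  using assms by (induction m arbitrary: k) (auto intro: draws_at_most.intros)

definition batch_size :: "nat \<Rightarrow> real \<Rightarrow> nat" where
  "batch_size n \<epsilon> = nat \<lceil>1152 * sqrt (real n) / \<epsilon>\<^sup>2\<rceil>"

text \<open>The factor 3/4 is midway between the means \<open>m^2 * \<epsilon>^2 / 2\<close> and
  \<open>m^2 * \<epsilon>^2\<close> that delimit the two cases.\<close>

definition verdict_of :: "nat \<Rightarrow> real \<Rightarrow> nat pmf \<Rightarrow> nat list \<Rightarrow> nat list \<Rightarrow> verdict" where
  "verdict_of n \<epsilon> q xs ys =
    (if stat {1..n} (weight n \<epsilon> q) (batch_size n \<epsilon>) q xs ys < 3 / 4 * ((real (batch_size n \<epsilon>))\<^sup>2 * \<epsilon>\<^sup>2)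
     then Close else Far)"

text \<open>For \<epsilon> above 1 no distribution is far, so \<open>Close\<close> is safe; the
  permitted number of samples may then also fall below one.\<close>

definition tester :: "nat \<Rightarrow> real \<Rightarrow> nat pmf \<Rightarrow> procedure" where
  "tester n \<epsilon> q = (if \<epsilon> > 1 then Output Close else
     draw_list (batch_size n \<epsilon>) (\<lambda>xs. draw_list (batch_size n \<epsilon>) (\<lambda>ys.
       Output (verdict_of n \<epsilon> q xs ys))))"

lemma run_tester:
  assumes "\<epsilon> \<le> 1"
  shows "run p (tester n \<epsilon> q) = map_pmf (\<lambda>z. verdict_of n \<epsilon> q (fst z) (snd z))
    (pair_pmf (replicate_pmf (batch_size n \<epsilon>) p) (replicate_pmf (batch_size n \<epsilon>) p))"
  using assms
  by (simp add: tester_def run_draw_list map_pmf_def pair_pmf_def bind_assoc_pmf bind_return_pmf)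

lemma tester_sample_bound:
  assumes "n \<ge> 1" and "\<epsilon> > 0"
  shows "\<exists>m. real m \<le> 2306 * sqrt (real n) / \<epsilon>\<^sup>2 \<and> draws_at_most m (tester n \<epsilon> q)"
proof (cases "\<epsilon> > 1")
  case True
  then show ?thesis
    using assms by (intro exI[of _ 0]) (auto simp: tester_def intro: draws_at_most.intros)
next
  case False
  let ?m = "batch_size n \<epsilon>"
  have "\<epsilon>\<^sup>2 \<le> 1"
    using False assms by (simp add: power_le_one)
  moreover have "1 \<le> sqrt (real n)"
    using assms by simp
  \<comment> \<open>This lets the rounding in each batch be absorbed, whence the constant
    \<open>2306 = 2 * (1152 + 1)\<close>.\<close>
  ultimately have "1 \<le> sqrt (real n) / \<epsilon>\<^sup>2"
    using assms by (simp add: le_divide_eq del: real_sqrt_ge_1_iff)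
  moreover have "real ?m \<le> 1152 * (sqrt (real n) / \<epsilon>\<^sup>2) + 1"
    unfolding batch_size_def times_divide_eq_right
    using assms of_int_ceiling_le_add_one[of "1152 * sqrt (real n) / \<epsilon>\<^sup>2"]
    by (subst of_nat_nat) (simp_all add: le_ceiling_iff less_le_trans[of "-1" 0])
  ultimately have "real (?m + ?m) \<le> 2306 * (sqrt (real n) / \<epsilon>\<^sup>2)"
    by simp
  moreover have "draws_at_most (?m + ?m) (tester n \<epsilon> q)"
    using False draws_at_most_draw_list[of 0, OF draws_at_most.intros(1)]
    by (auto simp: tester_def intro!: draws_at_most_draw_list)
  ultimately show ?thesis
    by (intro exI[of _ "?m + ?m"]) simp
qed

section \<open>Correctness of the tester\<close>

lemma prob_map_pmf_singleton_ge:
  assumes "measure_pmf.prob P {z. a \<le> \<bar>D z\<bar>} \<le> \<delta>"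
    and "\<And>z. \<bar>D z\<bar> < (a::real) \<Longrightarrow> f z = v"
  shows "measure_pmf.prob (map_pmf f P) {v} \<ge> 1 - \<delta>"
proof -
  have "1 - \<delta> \<le> measure_pmf.prob P (UNIV - {z. a \<le> \<bar>D z\<bar>})"
    using assms(1) measure_pmf.prob_compl[of "{z. a \<le> \<bar>D z\<bar>}" P] by simp
  also have "\<dots> \<le> measure_pmf.prob P (f -` {v})"
    using assms(2) by (intro measure_pmf.finite_measure_mono) (auto simp: not_le)
  finally show ?thesis
    by (simp add: measure_map_pmf)
qed

context
  fixes n :: nat and \<epsilon> :: real and p q :: "nat pmf"
  assumes n: "n \<ge> 1" and \<epsilon>: "\<epsilon> > 0" and p: "distr_on n p" and q: "distr_on n q"
begin

lemma batch_size_ge: "1152 * sqrt (real n) / \<epsilon>\<^sup>2 \<le> real (batch_size n \<epsilon>)"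
  unfolding batch_size_def by (rule real_nat_ceiling_ge)

lemma tester_close:
  assumes "l2_dist n p q \<le> \<epsilon>\<^sup>2 / sqrt (real n)"
  shows "measure_pmf.prob (run p (tester n \<epsilon> q)) {Close} \<ge> 2 / 3"
proof (cases "\<epsilon> > 1")
  case True
  then show ?thesis by (simp add: tester_def)
next
  case False
  let ?m = "real (batch_size n \<epsilon>)"
  let ?T = "\<Sum>i=1..n. weight n \<epsilon> q i * (pmf p i - pmf q i)\<^sup>2"
  have T: "?T \<le> \<epsilon>\<^sup>2 / 2"
    by (rule weighted_dist_close[OF n \<epsilon> assms])
  then have "?m\<^sup>2 * ?T \<le> ?m\<^sup>2 * (\<epsilon>\<^sup>2 / 2)"
    by (rule mult_left_mono) simp
  then have v: "verdict_of n \<epsilon> q xs ys = Close"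
    if "\<bar>stat {1..n} (weight n \<epsilon> q) (batch_size n \<epsilon>) q xs ys - ?m\<^sup>2 * ?T\<bar> < ?m\<^sup>2 * \<epsilon>\<^sup>2 / 4" for xs ys
    using that unfolding verdict_of_def abs_less_iff by (intro if_P) linarith
  \<comment> \<open>The scale is \<open>M = \<epsilon>^2\<close> and not \<open>?T\<close>, which
    may be 0 here. Adding the deviation \<open>m^2 * \<epsilon>^2 / 4\<close> to the mean stays
    below the threshold.\<close>
  have "?T \<le> \<epsilon>\<^sup>2"
    using T zero_le_power2[of \<epsilon>] by linarith
  from prob_map_pmf_singleton_ge[OF stat_concentration[OF n \<epsilon> batch_size_ge p this order_refl] v]
  show ?thesis
    using False by (simp add: run_tester)
qed

lemma tester_far:
  assumes "hellinger_dist n p q \<ge> \<epsilon>"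
  shows "measure_pmf.prob (run p (tester n \<epsilon> q)) {Far} \<ge> 2 / 3"
proof -
  have "\<epsilon> \<le> 1"
    using assms hellinger_dist_le_1[OF p q] by linarith
  let ?m = "real (batch_size n \<epsilon>)"
  let ?T = "\<Sum>i=1..n. weight n \<epsilon> q i * (pmf p i - pmf q i)\<^sup>2"
  have T: "\<epsilon>\<^sup>2 \<le> ?T"
    by (rule weighted_dist_far[OF n \<epsilon> assms])
  then have "?m\<^sup>2 * \<epsilon>\<^sup>2 \<le> ?m\<^sup>2 * ?T"
    by (rule mult_left_mono) simp
  then have v: "verdict_of n \<epsilon> q xs ys = Far"
    if "\<bar>stat {1..n} (weight n \<epsilon> q) (batch_size n \<epsilon>) q xs ys - ?m\<^sup>2 * ?T\<bar> < ?m\<^sup>2 * ?T / 4" for xs ys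
    using that unfolding verdict_of_def abs_less_iff by (intro if_not_P) linarith
  \<comment> \<open>Now the scale is \<open>M = ?T\<close>: the variance grows with the distance, so
    the deviation must be relative. Three quarters of the mean still reach the threshold.\<close>
  from prob_map_pmf_singleton_ge[OF stat_concentration[OF n \<epsilon> batch_size_ge p order_refl T] v]
  show ?thesis
    using \<open>\<epsilon> \<le> 1\<close> by (simp add: run_tester)
qed

end

theorem theorem3p3:
  shows "\<exists>(C::real) (alg :: nat \<Rightarrow> real \<Rightarrow> nat pmf \<Rightarrow> procedure). C > 0 \<and>
    (\<forall>n \<epsilon> q. n \<ge> 1 \<longrightarrow> \<epsilon> > 0 \<longrightarrow> distr_on n q \<longrightarrow>
      (\<exists>m::nat. real m \<le> C * sqrt (real n) / \<epsilon>\<^sup>2 \<and> draws_at_most m (alg n \<epsilon> q)) \<and>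
      (\<forall>p. distr_on n p \<longrightarrow>
        (l2_dist n p q \<le> \<epsilon>\<^sup>2 / sqrt (real n) \<longrightarrow>
          measure_pmf.prob (run p (alg n \<epsilon> q)) {Close} \<ge> 2 / 3) \<and>
        (hellinger_dist n p q \<ge> \<epsilon> \<longrightarrow>
          measure_pmf.prob (run p (alg n \<epsilon> q)) {Far} \<ge> 2 / 3)))"
  by (rule exI[of _ 2306], rule exI[of _ tester])
     (intro conjI allI impI tester_close tester_far tester_sample_bound; simp)

end
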